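(* Let $G$ be a finite group, let $L(G)$ be the set of all subgroups of $G$, and let $\mathrm{Isolated}(G)\subseteq L(G)$ be the set of isolated subgroups of $G$. Then: (a) $\mathrm{Isolated}(G)=L(G)$ if and only if $G$ is a $\mathrm{CP}_1$-group; (b) $|\mathrm{Isolated}(G)|=|L(G)|-1$ if and only if $G\cong\mathbb{Z}_{p^2}$ for some prime $p$; (c) $|\mathrm{Isolated}(G)|=|L(G)|-2$ if and only if $G\cong\mathbb{Z}_{p^3}$ for some prime $p$ or $G\cong\mathbb{Z}_{pq}$ for some distinct primes $p$ and $q$.
   Context: For a finite group $G$, $L(G)$ denotes the subgroup lattice of $G$, i.e. the set of all subgroups of $G$ (including the trivial subgroup $1$ and $G$ itself). A subgroup $H\in L(G)$ is called isolated in $G$ if for every $x\in G$ we have either $x\in H$ or $\langle x\rangle\cap H=1$, where $\langle x\rangle$ is the cyclic subgroup generated by $x$ and $1$ is the trivial subgroup. $\mathrm{Isolated}(G)$ denotes the set of all isolated subgroups of $G$. A group is called a $\mathrm{CP}_1$-group if all its non-identity elements have prime order (the trivial group is thus a $\mathrm{CP}_1$-group). $\mathbb{Z}_n$ denotes the cyclic group of order $n$. *)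

theory Defs
  imports "HOL-Algebra.Algebra"
begin

definition subgroups :: "('a, 'b) monoid_scheme \<Rightarrow> 'a set set" where
  "subgroups G = {H. subgroup H G}"

definition isolated :: "('a, 'b) monoid_scheme \<Rightarrow> 'a set \<Rightarrow> bool" where
  "isolated G H \<longleftrightarrow>
     subgroup H G \<and> (\<forall>x\<in>carrier G. x \<in> H \<or> generate G {x} \<inter> H = {\<one>\<^bsub>G\<^esub>})"

definition isolated_subgroups :: "('a, 'b) monoid_scheme \<Rightarrow> 'a set set" where
  "isolated_subgroups G = {H. isolated G H}"

definition CP1_group :: "('a, 'b) monoid_scheme \<Rightarrow> bool" where
  "CP1_group G \<longleftrightarrow>
     group G \<and>
     (\<forall>x\<in>carrier G. x \<noteq> \<one>\<^bsub>G\<^esub> \<longrightarrow> Factorial_Ring.prime (group.ord G x))"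

end

theory Submission
  imports Defs
begin

text \<open>
  Everything is phrased through the set \<open>N\<close> of non-isolated subgroups: the three claims say that
  \<open>N\<close> has 0, 1 or 2 elements exactly for the listed groups. Call an element composite if it is
  not the identity and its order is not prime.

  Two observations govern \<open>N\<close>. If \<open>x\<close> is composite, then every proper nontrivial subgroup
  of \<open>\<langle>x\<rangle>\<close> is non-isolated, as \<open>x\<close> itself testifies
  (\<open>proper_subgroup_of_cyclic_nonisolated\<close>). Conversely, an element testifying that a subgroup is not
  isolated must be composite, since an element of prime order lies in every subgroup that meets
  its cyclic subgroup nontrivially (\<open>nonisolated_witness\<close>). Hence \<open>N\<close> is empty exactly when there
  are no composite elements, which is (a).

  For (b) and (c) the main point is that one or two non-isolated subgroups force \<open>G\<close> to be cyclic
  (\<open>nonisolated_le_2_imp_cyclic\<close>). The recurring device is to take two subgroups \<open>H\<close> and \<open>K\<close>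
  such that one normalises the other and \<open>H\<close> is a proper nontrivial subgroup of \<open>\<langle>x\<rangle>\<close>, and to ask
  whether \<open>x\<close> lies in \<open>HK\<close>. If not, then \<open>HK\<close> belongs to \<open>N\<close>, and \<open>N\<close> is small. If so, write
  \<open>x = hk\<close>; then \<open>k\<close> is a nontrivial element of \<open>K \<inter> \<langle>x\<rangle>\<close>, which ties \<open>K\<close> to \<open>\<langle>x\<rangle>\<close>.
  The normalisation comes for free, because conjugation permutes \<open>N\<close> and preserves cardinalities.
  The argument splits according to whether all members of \<open>N\<close> lie in one cyclic subgroup
  generated by a composite element (\<open>cyclic_if_nonisolated_subset_cyclic\<close>) or not, which is
  impossible when \<open>N\<close> has at most two elements.

  Once \<open>G\<close> is cyclic of order \<open>n > 1\<close>, every subgroup other than the trivial one and \<open>G\<close> is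
  non-isolated, so \<open>N\<close> has two elements fewer than \<open>n\<close> has divisors. It remains to find the
  numbers with three or four divisors: these are \<open>p\<^sup>2\<close>, and \<open>p\<^sup>3\<close> or \<open>pq\<close>, respectively.
\<close>

section \<open>Non-isolated subgroups and elements of composite order\<close>

definition nonisolated_subgroups :: "('a, 'b) monoid_scheme \<Rightarrow> 'a set set" where
  "nonisolated_subgroups G = subgroups G - isolated_subgroups G"

context group
begin

lemma subgroup_eq_trivial_iff:
  assumes "subgroup H G"
  shows "H = {\<one>} \<longleftrightarrow> (\<forall>h\<in>H. h = \<one>)"
  using subgroup.one_closed[OF assms] by auto

lemma nonisolated_iff:
  "H \<in> nonisolated_subgroups G \<longleftrightarrow>
     subgroup H G \<and> (\<exists>x\<in>carrier G. x \<notin> H \<and> (\<exists>k\<in>generate G {x}. k \<in> H \<and> k \<noteq> \<one>))"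
proof (cases "subgroup H G")
  case True
  have "generate G {x} \<inter> H = {\<one>} \<longleftrightarrow> (\<forall>k\<in>generate G {x}. k \<in> H \<longrightarrow> k = \<one>)"
    if "x \<in> carrier G" for x
    using subgroup.one_closed[OF True] generate.one[of G "{x}"] by auto
  with True show ?thesis
    unfolding nonisolated_subgroups_def subgroups_def isolated_subgroups_def isolated_def by blast
qed (simp add: nonisolated_subgroups_def subgroups_def)

lemma nonisolatedI:
  assumes "subgroup H G" "x \<in> carrier G" "x \<notin> H" "k \<in> generate G {x}" "k \<in> H" "k \<noteq> \<one>"
  shows "H \<in> nonisolated_subgroups G"
  using assms by (auto simp: nonisolated_iff)

lemma cyclic_subgroup: "x \<in> carrier G \<Longrightarrow> subgroup (generate G {x}) G"
  by (simp add: generate_is_subgroup)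

lemma generator_mem: "x \<in> generate G {x}"
  by (simp add: generate.incl)

lemma generate_singleton_subset: "subgroup H G \<Longrightarrow> x \<in> H \<Longrightarrow> generate G {x} \<subseteq> H"
  by (simp add: generate_subgroup_incl)

lemma proper_subgroup_of_cyclic_nonisolated:
  assumes "x \<in> carrier G" "subgroup L G" "L \<noteq> {\<one>}" "L \<subset> generate G {x}"
  shows "L \<in> nonisolated_subgroups G"
proof -
  obtain k where "k \<in> L" "k \<noteq> \<one>"
    using assms(2,3) subgroup_eq_trivial_iff by blast
  moreover have "x \<notin> L"
    using assms generate_singleton_subset by blast
  ultimately show ?thesis
    using assms by (intro nonisolatedI[of L x k]) auto
qed

text \<open>The exponents that take \<open>x\<close> into \<open>H\<close> are the multiples of the least positive one, by division
  with remainder. As \<open>ord x\<close> is such an exponent, this least one divides it.\<close>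

lemma subgroup_of_cyclic:
  assumes "x \<in> carrier G" "finite (carrier G)" "subgroup H G" "H \<subseteq> generate G {x}"
  obtains m where "m dvd ord x" "H = generate G {x [^] m}"
proof -
  define m where "m = (LEAST m::nat. 0 < m \<and> x [^] m \<in> H)"
  have "ord x > 0"
    using assms ord_ge_1 by fastforce
  moreover have one: "x [^] ord x \<in> H"
    using assms by (simp add: subgroup.one_closed)
  ultimately have m: "0 < m" "x [^] m \<in> H"
    unfolding m_def by (metis (mono_tags, lifting) LeastI)+
  have dvd: "m dvd k" if "x [^] k \<in> H" for k :: nat
  proof (rule ccontr)
    assume "\<not> m dvd k"
    then have pos: "0 < k mod m" by (simp add: mod_greater_zero_iff_not_dvd)
    have "x [^] k = x [^] (m * (k div m)) \<otimes> x [^] (k mod m)"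
      using assms(1) by (simp add: nat_pow_mult)
    moreover have q: "x [^] (m * (k div m)) \<in> H"
      using m assms subgroup_int_pow_closed[of H "x [^] m" "int (k div m)"]
      by (simp add: int_pow_int nat_pow_pow)
    ultimately have "x [^] (k mod m) = inv (x [^] (m * (k div m))) \<otimes> x [^] k"
      using assms(1) by (simp add: inv_solve_left)
    then have "x [^] (k mod m) \<in> H"
      using q that assms(3) by (simp add: subgroup.m_closed subgroup.m_inv_closed)
    then have "m \<le> k mod m"
      using pos unfolding m_def by (intro Least_le) auto
    then show False
      using \<open>0 < m\<close> by (meson mod_less_divisor not_less)
  qed
  have "H \<subseteq> generate G {x [^] m}"
  proof
    fix h assume h: "h \<in> H"
    then obtain k :: nat where k: "h = x [^] k"
      using assms generate_pow_on_finite_carrier by fastforce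
    then obtain j where "k = m * j"
      using dvd h by blast
    then have "h = (x [^] m) [^] j"
      using k assms(1) by (simp add: nat_pow_pow)
    then show "h \<in> generate G {x [^] m}"
      using assms(1,2) by (auto simp: generate_pow_on_finite_carrier)
  qed
  with m assms(3) have "H = generate G {x [^] m}"
    by (simp add: generate_singleton_subset subset_antisym)
  with dvd[OF one] show thesis by (rule that)
qed

lemma card_generate_pow:
  assumes "x \<in> carrier G" "finite (carrier G)" "m dvd ord x"
  shows "card (generate G {x [^] m}) * m = ord x"
proof -
  have "m \<noteq> 0" using assms ord_ge_1 by fastforce
  with assms show ?thesis
    by (simp add: ord_pow flip: generate_pow_card)
qed

text \<open>The exponent describing a subgroup of a finite cyclic group is the index of the subgroup, so
  the cardinality determines it.\<close>

lemma subgroup_of_cyclic_eqI: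
  assumes x: "x \<in> carrier G" and fin: "finite (carrier G)"
    and H: "subgroup H G" "H \<subseteq> generate G {x}" and K: "subgroup K G" "K \<subseteq> generate G {x}"
    and card: "card H = card K"
  shows "H = K"
proof -
  obtain m where m: "m dvd ord x" "H = generate G {x [^] m}"
    using subgroup_of_cyclic[OF x fin H] .
  obtain l where l: "l dvd ord x" "K = generate G {x [^] l}"
    using subgroup_of_cyclic[OF x fin K] .
  have "card K * m = card K * l"
    using card_generate_pow[OF x fin] m l card by metis
  moreover have "card K > 0"
    using K fin subgroup.finite_imp_card_positive by blast
  ultimately show ?thesis using m l by simp
qed

text \<open>The order of \<open>k\<close> divides a prime and is not 1, so \<open>k\<close> generates all of \<open>\<langle>x\<rangle>\<close>.\<close>

lemma prime_order_generator:
  assumes "x \<in> carrier G" "finite (carrier G)" "Factorial_Ring.prime (ord x)"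
    and k: "k \<in> generate G {x}" "k \<noteq> \<one>"
  shows "x \<in> generate G {k}"
proof -
  have kc: "k \<in> carrier G" using assms generate_in_carrier by blast
  have sub: "subgroup (generate G {k}) G" "generate G {k} \<subseteq> generate G {x}"
    using assms kc by (auto intro: cyclic_subgroup generate_singleton_subset[THEN subsetD])
  obtain m where m: "m dvd ord x" "generate G {k} = generate G {x [^] m}"
    using subgroup_of_cyclic[OF assms(1,2) sub] .
  have "ord k * m = ord x"
    using card_generate_pow[OF assms(1,2) m(1)] m(2) generate_pow_card[OF kc] by simp
  moreover have "ord k \<noteq> 1" using ord_eq_1[OF kc] k by simp
  ultimately have "m = 1"
    using assms(3) by (metis nat_mult_eq_1_iff prime_product)
  then show ?thesis using m assms(1) generator_mem by simp
qed

text \<open>For a prime \<open>p\<close> dividing \<open>ord x\<close> the subgroup \<open>\<langle>x\<^sup>p\<rangle>\<close> has index \<open>p\<close>, and it is nontrivial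
  because \<open>ord x \<noteq> p\<close>.\<close>

lemma composite_order_subgroup:
  assumes "x \<in> carrier G" "finite (carrier G)" "x \<noteq> \<one>" "\<not> Factorial_Ring.prime (ord x)"
  obtains L where "subgroup L G" "L \<noteq> {\<one>}" "L \<subset> generate G {x}"
proof -
  have "ord x \<noteq> 1" using ord_eq_1 assms by blast
  then obtain p where p: "Factorial_Ring.prime p" "p dvd ord x"
    using prime_factor_nat by blast
  let ?L = "generate G {x [^] p}"
  have card: "card ?L * p = ord x"
    using assms p by (intro card_generate_pow) auto
  have sub: "subgroup ?L G" using assms by (simp add: cyclic_subgroup)
  moreover have "?L \<noteq> {\<one>}"
    using card p assms(4) by auto
  moreover have "?L \<subseteq> generate G {x}"
    using assms by (intro generate_singleton_subset cyclic_subgroup)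
      (auto simp: generate_pow_on_finite_carrier)
  moreover have "?L \<noteq> generate G {x}"
    using card p(1) assms ord_ge_1[of x] generate_pow_card[of x] prime_gt_1_nat[OF p(1)] by auto
  ultimately show thesis using that by blast
qed

text \<open>If \<open>x\<close> has prime order and \<open>\<langle>x\<rangle>\<close> meets \<open>H\<close> nontrivially, then any common nontrivial element
  generates \<open>\<langle>x\<rangle>\<close>, whence \<open>x \<in> H\<close>. So a witness against isolation is composite.\<close>

lemma nonisolated_witness:
  assumes "finite (carrier G)" "H \<in> nonisolated_subgroups G"
  obtains x where "x \<in> carrier G" "x \<notin> H" "generate G {x} \<inter> H \<noteq> {\<one>}"
    "x \<noteq> \<one>" "\<not> Factorial_Ring.prime (ord x)"
proof -
  obtain x k where H: "subgroup H G" and x: "x \<in> carrier G" "x \<notin> H"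
    and k: "k \<in> generate G {x}" "k \<in> H" "k \<noteq> \<one>"
    using assms(2) nonisolated_iff by auto
  have "\<not> Factorial_Ring.prime (ord x)"
    using prime_order_generator[OF x(1) assms(1)] k generate_singleton_subset[OF H k(2)] x(2) by blast
  moreover have "x \<noteq> \<one>" using x(2) H subgroup.one_closed by blast
  ultimately show thesis using that x k by blast
qed

lemma nonisolated_empty_iff:
  assumes "finite (carrier G)"
  shows "nonisolated_subgroups G = {} \<longleftrightarrow> CP1_group G"
proof
  assume N: "nonisolated_subgroups G = {}"
  show "CP1_group G"
    unfolding CP1_group_def
  proof (intro conjI ballI impI, rule is_group, rule ccontr)
    fix x assume "x \<in> carrier G" "x \<noteq> \<one>" "\<not> Factorial_Ring.prime (ord x)"
    then show False
      using composite_order_subgroup[of x] proper_subgroup_of_cyclic_nonisolated[of x] N assms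
      by (metis empty_iff)
  qed
next
  assume "CP1_group G"
  then show "nonisolated_subgroups G = {}"
    using nonisolated_witness[OF assms] unfolding CP1_group_def by (metis equals0I)
qed

lemma conjugation_iso:
  assumes "g \<in> carrier G"
  shows "(\<lambda>h. g \<otimes> h \<otimes> inv g) \<in> iso G G"
proof -
  have "g \<otimes> (x \<otimes> y) \<otimes> inv g = (g \<otimes> x \<otimes> inv g) \<otimes> (g \<otimes> y \<otimes> inv g)"
    if "x \<in> carrier G" "y \<in> carrier G" for x y
    using that assms by (simp add: inv_solve_left m_assoc)
  moreover have "bij_betw (\<lambda>h. g \<otimes> h \<otimes> inv g) (carrier G) (carrier G)"
    using conjugation_is_bij[OF assms] by (simp cong: bij_betw_cong)
  ultimately show ?thesis
    using assms by (auto simp: iso_def hom_def)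
qed

lemma automorphism_image_nonisolated:
  assumes \<phi>: "\<phi> \<in> iso G G" and L: "L \<in> nonisolated_subgroups G"
  shows "\<phi> ` L \<in> nonisolated_subgroups G"
proof -
  interpret \<phi>: group_hom G G \<phi>
    using \<phi> by (simp add: group_hom_def group_hom_axioms_def is_group iso_imp_homomorphism)
  have inj: "inj_on \<phi> (carrier G)" using \<phi> by (auto simp: iso_def bij_betw_def)
  obtain x k where sub: "subgroup L G" and x: "x \<in> carrier G" "x \<notin> L"
    and k: "k \<in> generate G {x}" "k \<in> L" "k \<noteq> \<one>"
    using L nonisolated_iff by auto
  have Lc: "L \<subseteq> carrier G" using sub subgroup.subset by blast
  show ?thesis
  proof (rule nonisolatedI)
    show "subgroup (\<phi> ` L) G" using sub \<phi>.subgroup_img_is_subgroup by blast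
    show "\<phi> x \<in> carrier G" using x by simp
    show "\<phi> x \<notin> \<phi> ` L" using x inj Lc by (auto dest: inj_onD)
    show "\<phi> k \<in> generate G {\<phi> x}" using \<phi>.generate_img[of "{x}"] x k by auto
    show "\<phi> k \<in> \<phi> ` L" using k by simp
    show "\<phi> k \<noteq> \<one>" using k Lc inj by (metis inj_onD one_closed \<phi>.hom_one subsetD)
  qed
qed

text \<open>This is the source of all normality below: a member of \<open>N\<close> that is the only one of its size is
  a normal subgroup.\<close>

lemma conjugate_nonisolated:
  assumes "g \<in> carrier G" "L \<in> nonisolated_subgroups G"
  shows "(\<lambda>h. g \<otimes> h \<otimes> inv g) ` L \<in> nonisolated_subgroups G"
    and "card ((\<lambda>h. g \<otimes> h \<otimes> inv g) ` L) = card L"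
proof -
  show "(\<lambda>h. g \<otimes> h \<otimes> inv g) ` L \<in> nonisolated_subgroups G"
    using assms conjugation_iso automorphism_image_nonisolated by blast
  have "L \<subseteq> carrier G" using assms nonisolated_iff subgroup.subset by blast
  then have "inj_on (\<lambda>h. g \<otimes> h \<otimes> inv g) L"
    using conjugation_iso[OF assms(1)] by (auto simp: iso_def bij_betw_def intro: inj_on_subset)
  then show "card ((\<lambda>h. g \<otimes> h \<otimes> inv g) ` L) = card L"
    by (rule card_image)
qed

lemma set_mult_subgroup:
  assumes H: "subgroup H G" and K: "subgroup K G"
    and norm: "\<And>k. k \<in> K \<Longrightarrow> (\<lambda>h. k \<otimes> h \<otimes> inv k) ` H \<subseteq> H"
  shows "subgroup (H <#> K) G"
proof (rule subgroupI)
  have Hc: "\<And>h. h \<in> H \<Longrightarrow> h \<in> carrier G" and Kc: "\<And>k. k \<in> K \<Longrightarrow> k \<in> carrier G"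
    using subgroup.mem_carrier[OF H] subgroup.mem_carrier[OF K] by auto
  show "H <#> K \<subseteq> carrier G" using Hc Kc by (auto simp: set_mult_def)
  show "H <#> K \<noteq> {}" using H K subgroup.one_closed by (fastforce simp: set_mult_def)
  fix a assume "a \<in> H <#> K"
  then obtain h k where a: "h \<in> H" "k \<in> K" "a = h \<otimes> k" by (auto simp: set_mult_def)
  have ik: "inv k \<in> K" and ih: "inv h \<in> H" using a H K by (auto intro: subgroup.m_inv_closed)
  have "inv a = (inv k \<otimes> inv h \<otimes> inv (inv k)) \<otimes> inv k"
    using a Hc Kc by (simp add: inv_mult_group m_assoc)
  moreover have "inv k \<otimes> inv h \<otimes> inv (inv k) \<in> H"
    using norm[OF ik] ih by blast
  ultimately show "inv a \<in> H <#> K"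
    using ik by (auto simp: set_mult_def)
  fix b assume "b \<in> H <#> K"
  then obtain h' k' where b: "h' \<in> H" "k' \<in> K" "b = h' \<otimes> k'" by (auto simp: set_mult_def)
  have "inv k \<otimes> (k \<otimes> k') = k'"
    using a b Kc by (simp flip: m_assoc)
  then have "a \<otimes> b = (h \<otimes> (k \<otimes> h' \<otimes> inv k)) \<otimes> (k \<otimes> k')"
    using a b Hc Kc by (simp add: m_assoc)
  moreover have "h \<otimes> (k \<otimes> h' \<otimes> inv k) \<in> H"
    using norm[OF a(2)] a b H by (auto intro: subgroup.m_closed)
  moreover have "k \<otimes> k' \<in> K" using a b K by (auto intro: subgroup.m_closed)
  ultimately show "a \<otimes> b \<in> H <#> K" by (auto simp: set_mult_def)
qed

lemma set_mult_supersets: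
  assumes "subgroup H G" "subgroup K G"
  shows "H \<subseteq> H <#> K" "K \<subseteq> H <#> K"
proof -
  have "h = h \<otimes> \<one>" if "h \<in> H" for h using that assms subgroup.mem_carrier by fastforce
  then show "H \<subseteq> H <#> K" using subgroup.one_closed[OF assms(2)] unfolding set_mult_def by blast
  have "k = \<one> \<otimes> k" if "k \<in> K" for k using that assms subgroup.mem_carrier by fastforce
  then show "K \<subseteq> H <#> K" using subgroup.one_closed[OF assms(1)] unfolding set_mult_def by blast
qed

lemma subgroup_left_factor:
  assumes "subgroup S G" "a \<in> carrier G" "b \<in> S" "a \<otimes> b \<in> S"
  shows "a \<in> S"
proof -
  have "a = (a \<otimes> b) \<otimes> inv b"
    using assms subgroup.mem_carrier[OF assms(1)] by (simp add: m_assoc)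
  then show ?thesis using assms by (metis subgroup.m_closed subgroup.m_inv_closed)
qed

lemma subgroup_right_factor:
  assumes "subgroup S G" "b \<in> carrier G" "a \<in> S" "a \<otimes> b \<in> S"
  shows "b \<in> S"
proof -
  have "b = inv a \<otimes> (a \<otimes> b)"
    using assms subgroup.mem_carrier[OF assms(1)] by (simp flip: m_assoc)
  then show ?thesis using assms by (metis subgroup.m_closed subgroup.m_inv_closed)
qed

section \<open>At most two non-isolated subgroups force cyclicity\<close>

text \<open>Choose \<open>x\<close> among the possible generators with \<open>\<langle>x\<rangle>\<close> as large as possible, and suppose that
  \<open>g\<close> lies outside \<open>\<langle>x\<rangle>\<close>. A subgroup of a cyclic group is determined by its size, and so the
  members of \<open>N\<close> are normal. If \<open>g\<close> has prime order, take a proper nontrivial subgroup \<open>H\<close> of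
  \<open>\<langle>x\<rangle>\<close> and consider \<open>H\<langle>g\<rangle>\<close>: it is not inside \<open>\<langle>x\<rangle>\<close>, hence isolated, and it meets \<open>\<langle>x\<rangle>\<close> in
  \<open>H\<close> at least, hence contains \<open>x\<close>. Factoring \<open>x\<close> shows that \<open>\<langle>g\<rangle>\<close> meets \<open>\<langle>x\<rangle>\<close> nontrivially, so that
  \<open>g \<in> \<langle>x\<rangle>\<close>. If \<open>g\<close> is composite, then \<open>\<langle>g\<rangle>\<close> is isolated and contains a member of \<open>N\<close>, which lies in \<open>\<langle>x\<rangle>\<close>; so \<open>x \<in> \<langle>g\<rangle>\<close>,
  against the choice of \<open>x\<close>.\<close>

lemma cyclic_if_nonisolated_subset_cyclic:
  assumes fin: "finite (carrier G)"
    and x0: "x\<^sub>0 \<in> carrier G" "x\<^sub>0 \<noteq> \<one>" "\<not> Factorial_Ring.prime (ord x\<^sub>0)"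
      "\<And>L. L \<in> nonisolated_subgroups G \<Longrightarrow> L \<subseteq> generate G {x\<^sub>0}"
  shows "\<exists>x\<in>carrier G. generate G {x} = carrier G"
proof -
  let ?N = "nonisolated_subgroups G"
  define P where "P x \<longleftrightarrow> x \<in> carrier G \<and> x \<noteq> \<one> \<and> \<not> Factorial_Ring.prime (ord x)
    \<and> (\<forall>L\<in>?N. L \<subseteq> generate G {x})" for x
  have "P x\<^sub>0" using x0 by (simp add: P_def)
  moreover have "\<forall>y. P y \<longrightarrow> ord y < Suc (order G)"
    using ord_le_group_order[OF fin] by (auto simp: P_def less_Suc_eq_le)
  ultimately obtain x where Px: "P x" and max: "\<And>y. P y \<Longrightarrow> ord y \<le> ord x"
    using ex_has_greatest_nat[of P x\<^sub>0 ord "Suc (order G)"] by auto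
  then have x: "x \<in> carrier G" "x \<noteq> \<one>" "\<not> Factorial_Ring.prime (ord x)"
    and Nx: "\<And>L. L \<in> ?N \<Longrightarrow> L \<subseteq> generate G {x}"
    by (auto simp: P_def)
  let ?X = "generate G {x}"
  have X: "subgroup ?X G" using x cyclic_subgroup by simp
  obtain H where H: "subgroup H G" "H \<noteq> {\<one>}" "H \<subset> ?X"
    using composite_order_subgroup[OF x(1) fin x(2,3)] .
  obtain h\<^sub>0 where h0: "h\<^sub>0 \<in> H" "h\<^sub>0 \<noteq> \<one>" using H subgroup_eq_trivial_iff by blast
  have HN: "H \<in> ?N" using x H by (intro proper_subgroup_of_cyclic_nonisolated)
  have xH: "x \<notin> H" using H generate_singleton_subset by blast
  have normal: "(\<lambda>h. k \<otimes> h \<otimes> inv k) ` H = H" if k: "k \<in> carrier G" for k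
  proof (rule subgroup_of_cyclic_eqI[OF x(1) fin])
    show "subgroup ((\<lambda>h. k \<otimes> h \<otimes> inv k) ` H) G"
      using conjugate_nonisolated(1)[OF k HN] nonisolated_iff by blast
  qed (use conjugate_nonisolated[OF k HN] Nx H in auto)
  have "carrier G \<subseteq> ?X"
  proof (rule subsetI, rule ccontr)
    fix g assume g: "g \<in> carrier G" "g \<notin> ?X"
    let ?g = "generate G {g}"
    have sg: "subgroup ?g G" using g cyclic_subgroup by simp
    have g1: "g \<noteq> \<one>" using g generate.one by metis
    show False
    proof (cases "Factorial_Ring.prime (ord g)")
      case True
      have sub: "subgroup (H <#> ?g) G"
        using H sg normal subgroup.mem_carrier[OF sg] by (intro set_mult_subgroup) auto
      have sup: "H \<subseteq> H <#> ?g" "g \<in> H <#> ?g"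
        using set_mult_supersets[OF H(1) sg] generator_mem by auto
      have "x \<in> H <#> ?g"
      proof (rule ccontr)
        assume "x \<notin> H <#> ?g"
        then have "H <#> ?g \<in> ?N"
          using sub x h0 sup H by (intro nonisolatedI[of _ x h\<^sub>0]) auto
        then show False using Nx sup g by blast
      qed
      then obtain h k where hk: "h \<in> H" "k \<in> ?g" "x = h \<otimes> k" by (auto simp: set_mult_def)
      have kX: "k \<in> ?X"
        using hk H subgroup.mem_carrier[OF sg] generator_mem[of x]
        by (intro subgroup_right_factor[OF X, of k h]) auto
      have "k \<noteq> \<one>" using hk xH subgroup.mem_carrier[OF H(1)] by auto
      then have "g \<in> generate G {k}" using prime_order_generator g True hk fin by blast
      then show False using generate_singleton_subset[OF X kX] g by blast
    next
      case False
      obtain L where L: "subgroup L G" "L \<noteq> {\<one>}" "L \<subset> ?g"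
        using composite_order_subgroup[OF g(1) fin g1 False] .
      obtain l where l: "l \<in> L" "l \<noteq> \<one>" using L subgroup_eq_trivial_iff by blast
      have "L \<in> ?N" using g L by (intro proper_subgroup_of_cyclic_nonisolated)
      then have LX: "L \<subseteq> ?X" by (rule Nx)
      have "x \<in> ?g"
      proof (rule ccontr)
        assume "x \<notin> ?g"
        then have "?g \<in> ?N" using sg x l L LX by (intro nonisolatedI[of _ x l]) auto
        then show False using Nx g generator_mem by blast
      qed
      then have Xg: "?X \<subseteq> ?g" by (rule generate_singleton_subset[OF sg])
      then have "P g" using g g1 False Nx unfolding P_def by blast
      then have "card ?g \<le> card ?X" using max x g generate_pow_card by metis
      moreover have "finite ?g" using fin sg subgroup.subset finite_subset by blast
      ultimately have "?X = ?g" using Xg card_seteq by blast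
      then show False using g generator_mem by blast
    qed
  qed
  then show ?thesis using x X subgroup.subset by blast
qed

text \<open>Suppose \<open>G\<close> is not cyclic. By the previous lemma no composite element generates a subgroup
  containing all of \<open>N\<close>. Start with a composite \<open>x\<close> and a proper nontrivial subgroup \<open>H\<close> of \<open>\<langle>x\<rangle>\<close>; some
  \<open>H' \<in> N\<close> is not inside \<open>\<langle>x\<rangle>\<close>, and thus \<open>N = {H, H'}\<close>. Let \<open>y\<close> be a witness against isolation
  of \<open>H'\<close>.

  If \<open>H' \<subseteq> \<langle>y\<rangle>\<close>, the situation is symmetric: \<open>H\<close> and \<open>H'\<close> sit in two different cyclic
  subgroups, and neither contains the other. Then \<open>H\<close> normalises \<open>H'\<close>, and \<open>H'H\<close>
  contains \<open>x\<close>, for otherwise it would be a third member of \<open>N\<close>. Factoring \<open>x\<close> gives a nontrivial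
  element of \<open>H' \<inter> \<langle>x\<rangle>\<close>; it generates \<open>H'\<close>, because \<open>H'\<close> has no proper nontrivial subgroups; so \<open>H' \<subseteq> \<langle>x\<rangle>\<close>, a contradiction.

  Otherwise \<open>L = \<langle>y\<rangle> \<inter> H'\<close> is properly contained in \<open>H'\<close>, so \<open>N = {L, H'}\<close> and \<open>L\<close> is normal. For
  \<open>g \<in> H' - L\<close> the element \<open>gy\<close> lies neither in \<open>H'\<close> nor in \<open>\<langle>y\<rangle>\<close>. Considering \<open>L\<langle>gy\<rangle>\<close> shows first that
  \<open>gy\<close> is composite, then that \<open>\<langle>gy\<rangle>\<close> contains \<open>L\<close>, \<open>y\<close> and \<open>g\<close>. As \<open>L\<langle>g\<rangle>\<close> meets
  \<open>\<langle>y\<rangle>\<close> in \<open>L\<close> but misses \<open>y\<close>, it belongs to \<open>N\<close> and can only be \<open>H'\<close>. Now \<open>\<langle>gy\<rangle>\<close> contains all of \<open>N\<close>.\<close>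

lemma nonisolated_le_2_imp_cyclic:
  assumes fin: "finite (carrier G)"
    and N: "nonisolated_subgroups G \<noteq> {}" "card (nonisolated_subgroups G) \<le> 2"
  shows "\<exists>x\<in>carrier G. generate G {x} = carrier G"
proof (rule ccontr)
  assume noncyclic: "\<not> ?thesis"
  let ?N = "nonisolated_subgroups G"
  have escape: "\<exists>L\<in>?N. \<not> L \<subseteq> generate G {x}"
    if "x \<in> carrier G" "x \<noteq> \<one>" "\<not> Factorial_Ring.prime (ord x)" for x
    using cyclic_if_nonisolated_subset_cyclic[OF fin that] noncyclic by blast
  have sub: "subgroup L G" if "L \<in> ?N" for L using that nonisolated_iff by blast
  have "?N \<subseteq> Pow (carrier G)" using sub subgroup.subset by blast
  then have finN: "finite ?N" using fin by (meson finite_Pow_iff finite_subset)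
  have pair: "C = A \<or> C = B" if "A \<in> ?N" "B \<in> ?N" "A \<noteq> B" "C \<in> ?N" for A B C
  proof (rule ccontr)
    assume "\<not> ?thesis"
    then have "A \<noteq> C" "B \<noteq> C" by blast+
    then have "card {A, B, C} = 3" using that(3) by simp
    moreover have "card {A, B, C} \<le> card ?N" using that finN by (intro card_mono) auto
    ultimately show False using N by simp
  qed
  obtain L\<^sub>0 where "L\<^sub>0 \<in> ?N" using N by blast
  then obtain x where x: "x \<in> carrier G" "x \<noteq> \<one>" "\<not> Factorial_Ring.prime (ord x)"
    using nonisolated_witness[OF fin] by metis
  let ?X = "generate G {x}"
  have X: "subgroup ?X G" using x cyclic_subgroup by simp
  obtain H where H: "subgroup H G" "H \<noteq> {\<one>}" "H \<subset> ?X"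
    using composite_order_subgroup[OF x(1) fin x(2,3)] .
  have HN: "H \<in> ?N" using x H by (intro proper_subgroup_of_cyclic_nonisolated)
  obtain H' where H': "H' \<in> ?N" "\<not> H' \<subseteq> ?X" using escape[OF x] by blast
  then have HH': "H \<noteq> H'" using H by blast
  have sH': "subgroup H' G" using H' sub by blast
  obtain y where y: "y \<in> carrier G" "y \<notin> H'" "generate G {y} \<inter> H' \<noteq> {\<one>}"
    "y \<noteq> \<one>" "\<not> Factorial_Ring.prime (ord y)"
    using nonisolated_witness[OF fin H'(1)] .
  let ?Y = "generate G {y}"
  have Y: "subgroup ?Y G" using y cyclic_subgroup by simp
  show False
  proof (cases "H' \<subseteq> ?Y")
    case True
    have H'Y: "H' \<subset> ?Y" using True y(2) generator_mem by blast
    have HY: "\<not> H \<subseteq> ?Y" using escape[OF y(1,4,5)] pair[OF HN H'(1) HH'] True by blast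
    have norm: "(\<lambda>h. k \<otimes> h \<otimes> inv k) ` H' = H'" if k: "k \<in> H" for k
    proof (rule ccontr)
      have kc: "k \<in> carrier G" using k subgroup.mem_carrier[OF H(1)] by blast
      \<comment> \<open>Otherwise conjugation by \<open>k\<close> takes \<open>H'\<close> to \<open>H\<close>; but it fixes \<open>H\<close>, so undoing it yields \<open>H' \<subseteq> H\<close>.\<close>
      assume "\<not> ?thesis"
      then have eq: "(\<lambda>h. k \<otimes> h \<otimes> inv k) ` H' = H"
        using pair[OF HN H'(1) HH'] conjugate_nonisolated(1)[OF kc H'(1)] by blast
      have "H' \<subseteq> H"
      proof
        fix h assume h: "h \<in> H'"
        then have hc: "h \<in> carrier G" using subgroup.mem_carrier[OF sH'] by blast
        have khk: "(k \<otimes> h) \<otimes> inv k \<in> H" using eq h by blast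
        have ik: "inv k \<in> H" using k H(1) by (simp add: subgroup.m_inv_closed)
        have "k \<otimes> h \<in> H" using subgroup_left_factor[OF H(1) _ ik khk] kc hc by simp
        then show "h \<in> H" using subgroup_right_factor[OF H(1) hc k] by blast
      qed
      then show False using H H' by blast
    qed
    have sub': "subgroup (H' <#> H) G" using sH' H norm by (intro set_mult_subgroup) auto
    have sup: "H' \<subseteq> H' <#> H" "H \<subseteq> H' <#> H" using set_mult_supersets[OF sH' H(1)] by auto
    obtain h\<^sub>0 where h0: "h\<^sub>0 \<in> H" "h\<^sub>0 \<noteq> \<one>" using H subgroup_eq_trivial_iff by blast
    have "x \<in> H' <#> H"
    proof (rule ccontr)
      assume "x \<notin> H' <#> H"
      then have "H' <#> H \<in> ?N" using sub' x h0 sup H by (intro nonisolatedI[of _ x h\<^sub>0]) auto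
      then have "H' <#> H = H \<or> H' <#> H = H'" by (rule pair[OF HN H'(1) HH'])
      then show False using sup H H' HY True by blast
    qed
    then obtain k h where kh: "k \<in> H'" "h \<in> H" "x = k \<otimes> h" by (auto simp: set_mult_def)
    have kc: "k \<in> carrier G" using kh subgroup.mem_carrier[OF sH'] by blast
    have kX: "k \<in> ?X"
      using kh kc H generator_mem[of x] by (intro subgroup_left_factor[OF X, of k h]) auto
    have "x \<notin> H" using H generate_singleton_subset by blast
    then have k1: "k \<noteq> \<one>" using kh subgroup.mem_carrier[OF H(1)] by auto
    let ?K = "generate G {k}"
    have sK: "subgroup ?K G" using kc cyclic_subgroup by simp
    have KH': "?K \<subseteq> H'" using generate_singleton_subset sH' kh by blast
    \<comment> \<open>If \<open>\<langle>k\<rangle>\<close> is not all of \<open>H'\<close>, it is \<open>H\<close>; but \<open>H\<close> is not inside \<open>\<langle>y\<rangle>\<close>.\<close>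
    have "?K \<in> ?N"
      using y sK KH' H'Y k1 generator_mem[of k] by (intro proper_subgroup_of_cyclic_nonisolated[OF y(1)]) auto
    then have "?K = H'" using pair[OF HN H'(1) HH'] KH' True HY by blast
    then show False using generate_singleton_subset[OF X kX] H' by blast
  next
    case False
    let ?L = "?Y \<inter> H'"
    have L: "subgroup ?L G" using Y sH' subgroups_Inter_pair by blast
    have "?L \<subset> ?Y" using y generator_mem by blast
    then have LN: "?L \<in> ?N" using y L by (intro proper_subgroup_of_cyclic_nonisolated[OF y(1)]) auto
    have LH': "?L \<subset> H'" using False by blast
    have pair': "C = ?L \<or> C = H'" if "C \<in> ?N" for C using pair[OF LN H'(1) _ that] LH' by blast
    obtain l where l: "l \<in> ?L" "l \<noteq> \<one>" using y L subgroup_eq_trivial_iff by blast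
    have "finite H'" using sH' fin subgroup.subset finite_subset by blast
    then have "card ?L < card H'" using LH' psubset_card_mono by blast
    then have normal: "(\<lambda>h. k \<otimes> h \<otimes> inv k) ` ?L = ?L" if "k \<in> carrier G" for k
      using pair' conjugate_nonisolated[OF that LN] by fastforce
    have factor: "subgroup (?L <#> generate G {z}) G" "?L \<subseteq> ?L <#> generate G {z}"
      "z \<in> ?L <#> generate G {z}"
      "y \<in> ?L <#> generate G {z} \<or> ?L <#> generate G {z} \<in> ?N" if z: "z \<in> carrier G" for z
    proof -
      have sz: "subgroup (generate G {z}) G" using z cyclic_subgroup by simp
      show s: "subgroup (?L <#> generate G {z}) G"
        using L sz normal subgroup.mem_carrier[OF sz] by (intro set_mult_subgroup) auto
      show "?L \<subseteq> ?L <#> generate G {z}" "z \<in> ?L <#> generate G {z}"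
        using set_mult_supersets[OF L sz] generator_mem by auto
      then show "y \<in> ?L <#> generate G {z} \<or> ?L <#> generate G {z} \<in> ?N"
        using s y l nonisolatedI[of "?L <#> generate G {z}" y l] by blast
    qed
    obtain g where g: "g \<in> H'" "g \<notin> ?L" using LH' by blast
    have gc: "g \<in> carrier G" using g subgroup.mem_carrier[OF sH'] by blast
    \<comment> \<open>As \<open>y\<close> is outside \<open>H'\<close> and \<open>g\<close> outside \<open>\<langle>y\<rangle>\<close>, the product \<open>gy\<close> avoids both subgroups.\<close>
    let ?z = "g \<otimes> y"
    have zc: "?z \<in> carrier G" using gc y by simp
    have zH': "?z \<notin> H'" using subgroup_right_factor[OF sH' y(1) g(1)] y(2) by blast
    have zY: "?z \<notin> ?Y" using subgroup_left_factor[OF Y gc generator_mem] g by blast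
    let ?Z = "generate G {?z}"
    have Z: "subgroup ?Z G" using zc cyclic_subgroup by simp
    have "?L <#> ?Z \<notin> ?N" using factor[OF zc] pair'[of "?L <#> ?Z"] zH' by blast
    then have "y \<in> ?L <#> ?Z" using factor[OF zc] by blast
    then obtain h k where hk: "h \<in> ?L" "k \<in> ?Z" "y = h \<otimes> k" by (auto simp: set_mult_def)
    have kc: "k \<in> carrier G" using hk subgroup.mem_carrier[OF Z] by blast
    have kY: "k \<in> ?Y"
      using hk kc generator_mem[of y] by (intro subgroup_right_factor[OF Y, of k h]) auto
    have k1: "k \<noteq> \<one>"
    proof
      assume "k = \<one>"
      then have "y = h" using hk(3) subgroup.mem_carrier[OF L hk(1)] by simp
      then show False using hk(1) y(2) by blast
    qed
    \<comment> \<open>If \<open>gy\<close> had prime order, it would be a power of \<open>k\<close> and so lie in \<open>\<langle>y\<rangle>\<close>.\<close>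
    have zprime: "\<not> Factorial_Ring.prime (ord ?z)"
      using prime_order_generator[OF zc fin _ hk(2) k1] generate_singleton_subset[OF Y kY] zY by blast
    have z1: "?z \<noteq> \<one>" using zY generate.one by metis
    obtain M where M: "subgroup M G" "M \<noteq> {\<one>}" "M \<subset> ?Z"
      using composite_order_subgroup[OF zc fin z1 zprime] .
    have "M \<in> ?N" using zc M by (intro proper_subgroup_of_cyclic_nonisolated)
    \<comment> \<open>Either member of \<open>N\<close> contains \<open>\<langle>y\<rangle> \<inter> H'\<close>.\<close>
    then have LZ: "?L \<subseteq> ?Z" using pair'[of M] M LH' by blast
    have yZ: "y \<in> ?Z" using hk LZ Z by (auto intro: subgroup.m_closed)
    have gZ: "g \<in> ?Z" using subgroup_left_factor[OF Z gc yZ generator_mem] .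
    let ?K = "?L <#> generate G {g}"
    have "?K \<subseteq> H'" using subgroup.m_closed[OF sH'] generate_singleton_subset[OF sH' g(1)]
      by (auto simp: set_mult_def)
    then have "?K = H'" using factor[OF gc] pair'[of ?K] y(2) g by blast
    moreover have "?K \<subseteq> ?Z" using subgroup.m_closed[OF Z] generate_singleton_subset[OF Z gZ] LZ
      by (auto simp: set_mult_def)
    ultimately show False using escape[OF zc z1 zprime] pair' LZ by blast
  qed
qed

end

section \<open>Finite cyclic groups up to isomorphism\<close>

lemma (in group) cyclic_group_iff_generator:
  "cyclic_group G \<longleftrightarrow> (\<exists>x\<in>carrier G. generate G {x} = carrier G)"
proof -
  have "generate G {x} = range (\<lambda>n::int. x [^] n)" if "x \<in> carrier G" for x
    using generate_pow[OF that] by auto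
  then show ?thesis unfolding cyclic_group by metis
qed

lemma cyclic_integer_mod_group:
  assumes "n > 0"
  shows "cyclic_group (integer_mod_group n)"
proof (cases "n = 1")
  case True
  then show ?thesis using trivial_integer_mod_group trivial_imp_cyclic_group by blast
next
  case False
  have "carrier (integer_mod_group n) \<subseteq> range (\<lambda>k::int. 1 [^]\<^bsub>integer_mod_group n\<^esub> k)"
    using assms by (auto simp: carrier_integer_mod_group int_pow_integer_mod_group image_iff
        intro!: exI mod_pos_pos_trivial[symmetric])
  moreover have "range (\<lambda>k::int. 1 [^]\<^bsub>integer_mod_group n\<^esub> k) \<subseteq> carrier (integer_mod_group n)"
    using assms by (auto simp: carrier_integer_mod_group int_pow_integer_mod_group)
  ultimately show ?thesis
    using False group.cyclic_group[OF group_integer_mod_group, of n] integer_mod_group_1 by blast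
qed

text \<open>The inverse isomorphism sends a residue \<open>i\<close> to the \<open>i\<close>-th power of a generator.\<close>

lemma (in group) iso_integer_mod_group_iff:
  assumes "n > 0"
  shows "G \<cong> integer_mod_group n \<longleftrightarrow> cyclic_group G \<and> order G = n"
proof
  assume iso: "G \<cong> integer_mod_group n"
  have "order (integer_mod_group n) = n"
    using assms by (simp add: order_def carrier_integer_mod_group)
  moreover have "order G = order (integer_mod_group n)"
    using iso unfolding is_iso_def by (meson ex_in_conv iso_same_order)
  moreover have "cyclic_group G"
    using isomorphic_group_cyclicity[OF iso] cyclic_integer_mod_group[OF assms] is_group by auto
  ultimately show "cyclic_group G \<and> order G = n" by simp
next
  assume "cyclic_group G \<and> order G = n"
  then obtain x where x: "x \<in> carrier G" "generate G {x} = carrier G" and n: "order G = n"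
    using cyclic_group_iff_generator by blast
  have ord: "ord x = n" using x n generate_pow_card[of x] by (simp add: order_def)
  let ?f = "\<lambda>i::int. x [^] i"
  have "?f \<in> hom (integer_mod_group n) G"
  proof (rule homI)
    fix i j
    show "x [^] (i \<otimes>\<^bsub>integer_mod_group n\<^esub> j) = x [^] i \<otimes> x [^] j"
      using x ord by (simp add: int_pow_eq mod_eq_dvd_iff flip: int_pow_mult)
  qed (use x in simp)
  moreover have "inj_on ?f (carrier (integer_mod_group n))"
  proof (rule inj_onI)
    fix i j assume "i \<in> carrier (integer_mod_group n)" "j \<in> carrier (integer_mod_group n)"
      and "x [^] i = x [^] j"
    then have "int n dvd j - i" "0 \<le> i" "i < int n" "0 \<le> j" "j < int n"
      using assms x ord int_pow_eq by (auto simp: carrier_integer_mod_group)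
    then show "i = j" by (metis mod_eq_dvd_iff mod_pos_pos_trivial)
  qed
  moreover have "card (carrier (integer_mod_group n)) = card (carrier G)"
    using assms n by (simp add: carrier_integer_mod_group order_def)
  moreover have "?f ` carrier (integer_mod_group n) \<subseteq> carrier G" using x by auto
  moreover have "finite (carrier G)" using n assms order_gt_0_iff_finite by simp
  ultimately have "?f \<in> iso (integer_mod_group n) G"
    unfolding iso_def bij_betw_def by (simp add: card_image card_subset_eq)
  then show "G \<cong> integer_mod_group n"
    using group.iso_sym[OF group_integer_mod_group] is_isoI by blast
qed

section \<open>Counting non-isolated subgroups\<close>

lemma (in group) finite_subgroups:
  assumes "finite (carrier G)"
  shows "finite (subgroups G)"
proof (rule finite_subset)
  show "subgroups G \<subseteq> Pow (carrier G)"
    using subgroup.subset unfolding subgroups_def by blast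
qed (use assms in simp)

text \<open>The bijection sends a subgroup to its cardinality.\<close>

lemma (in group) card_subgroups_cyclic:
  assumes fin: "finite (carrier G)" and cyc: "cyclic_group G"
  shows "card (subgroups G) = card {d. d dvd order G}"
proof -
  obtain x where x: "x \<in> carrier G" "generate G {x} = carrier G"
    using cyc cyclic_group_iff_generator by blast
  have ord: "ord x = order G" using generate_pow_card[OF x(1)] x(2) by (simp add: order_def)
  have "inj_on card (subgroups G)"
  proof (rule inj_onI)
    fix H K assume "H \<in> subgroups G" "K \<in> subgroups G" "card H = card K"
    then show "H = K"
      using subgroup_of_cyclic_eqI[OF x(1) fin, of H K] x(2)
        subgroup.subset[of H G] subgroup.subset[of K G]
      by (simp add: subgroups_def)
  qed
  moreover have "card ` subgroups G = {d. d dvd order G}"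
  proof (intro equalityI subsetI)
    fix d assume "d \<in> {d. d dvd order G}"
    then obtain m where m: "order G = d * m" by auto
    then have "card (generate G {x [^] m}) * m = d * m"
      using card_generate_pow[OF x(1) fin, of m] ord by simp
    moreover have "m \<noteq> 0" using m fin order_gt_0_iff_finite by (metis mult_0_right less_irrefl)
    ultimately have "card (generate G {x [^] m}) = d" by simp
    then show "d \<in> card ` subgroups G"
      using x cyclic_subgroup[of "x [^] m"] unfolding subgroups_def by blast
  next
    fix d assume "d \<in> card ` subgroups G"
    then show "d \<in> {d. d dvd order G}"
      using lagrange by (auto simp: subgroups_def) (metis dvd_triv_right)
  qed
  ultimately show ?thesis by (metis card_image)
qed

text \<open>The trivial subgroup and \<open>G\<close> are always isolated, and a generator testifies against all others.
  The two are different because the order exceeds 1.\<close>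

lemma (in group) card_nonisolated_cyclic:
  assumes fin: "finite (carrier G)" and cyc: "cyclic_group G" and "order G > 1"
  shows "card (nonisolated_subgroups G) + 2 = card {d. d dvd order G}"
proof -
  obtain x where x: "x \<in> carrier G" "generate G {x} = carrier G"
    using cyc cyclic_group_iff_generator by blast
  have "nonisolated_subgroups G = subgroups G - {{\<one>}, carrier G}"
  proof (intro equalityI subsetI)
    fix H assume "H \<in> nonisolated_subgroups G"
    then show "H \<in> subgroups G - {{\<one>}, carrier G}"
      by (auto simp: nonisolated_iff subgroups_def)
  next
    fix H assume "H \<in> subgroups G - {{\<one>}, carrier G}"
    then show "H \<in> nonisolated_subgroups G"
      using x subgroup.subset[of H G]
      by (intro proper_subgroup_of_cyclic_nonisolated[OF x(1)]) (auto simp: subgroups_def)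
  qed
  moreover have "{{\<one>}, carrier G} \<subseteq> subgroups G"
    using triv_subgroup subgroup_self by (auto simp: subgroups_def)
  moreover have "carrier G \<noteq> {\<one>}"
    using assms(3) order_one_triv_iff by auto
  then have "card {{\<one>}, carrier G} = 2" by simp
  moreover note finite_subgroups[OF fin]
  ultimately show ?thesis
    using card_subgroups_cyclic[OF fin cyc] card_mono[of "subgroups G" "{{\<one>}, carrier G}"]
    by (simp add: card_Diff_subset)
qed

lemma (in group) card_nonisolated_eq_iff:
  assumes fin: "finite (carrier G)" and k: "k = 1 \<or> k = 2"
  shows "card (nonisolated_subgroups G) = k \<longleftrightarrow> cyclic_group G \<and> card {d. d dvd order G} = k + 2"
proof
  assume N: "card (nonisolated_subgroups G) = k"
  then have ne: "nonisolated_subgroups G \<noteq> {}" using k by auto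
  then have cyc: "cyclic_group G"
    using nonisolated_le_2_imp_cyclic[OF fin] N k cyclic_group_iff_generator by auto
  obtain H where "H \<in> nonisolated_subgroups G" using ne by blast
  then obtain x where "x \<in> carrier G" "x \<noteq> \<one>" using nonisolated_witness[OF fin] by metis
  then have "order G \<noteq> 1" using order_one_triv_iff by auto
  then have "order G > 1" using fin order_gt_0_iff_finite by linarith
  then show "cyclic_group G \<and> card {d. d dvd order G} = k + 2"
    using card_nonisolated_cyclic[OF fin cyc] cyc N by simp
next
  assume R: "cyclic_group G \<and> card {d. d dvd order G} = k + 2"
  then have "order G \<noteq> 1" using k by auto
  then have "order G > 1" using fin order_gt_0_iff_finite by linarith
  then show "card (nonisolated_subgroups G) = k"
    using card_nonisolated_cyclic[OF fin] R by fastforce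
qed

lemma (in group) card_isolated_plus_nonisolated:
  assumes "finite (carrier G)"
  shows "card (isolated_subgroups G) + card (nonisolated_subgroups G) = card (subgroups G)"
proof -
  have "isolated_subgroups G \<subseteq> subgroups G"
    by (auto simp: isolated_subgroups_def isolated_def subgroups_def)
  then show ?thesis
    unfolding nonisolated_subgroups_def
    using finite_subgroups[OF assms]
    by (simp add: card_Diff_subset card_mono finite_subset)
qed

section \<open>Numbers with three or four divisors\<close>

lemma divisor_count_prime_power:
  fixes p :: nat
  assumes p: "Factorial_Ring.prime p"
  shows "card {d. d dvd p ^ k} = k + 1"
proof -
  have "{d. d dvd p ^ k} = (\<lambda>i. p ^ i) ` {..k}"
    using divides_primepow_nat[OF p] by auto
  moreover have "inj_on (\<lambda>i. p ^ i) {..k}"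
    using prime_gt_1_nat[OF p] by (auto simp: inj_on_def)
  ultimately show ?thesis by (simp add: card_image)
qed

lemma divisor_count_prime_mult_prime:
  fixes p q :: nat
  assumes p: "Factorial_Ring.prime p" and q: "Factorial_Ring.prime q" and "p \<noteq> q"
  shows "card {d. d dvd p * q} = 4"
proof -
  have "d \<in> {1, p, q, p * q}" if "d dvd p * q" for d
  proof -
    obtain a b where "d = a * b" "a dvd p" "b dvd q"
      using division_decomp[OF \<open>d dvd p * q\<close>] by blast
    moreover have "a = 1 \<or> a = p" "b = 1 \<or> b = q"
      using p q \<open>a dvd p\<close> \<open>b dvd q\<close> by (auto simp: prime_nat_iff)
    ultimately show ?thesis by auto
  qed
  then have "{d. d dvd p * q} = {1, p, q, p * q}" by auto
  then show ?thesis
    using assms prime_gt_1_nat[OF p] prime_gt_1_nat[OF q] by auto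
qed

text \<open>Since \<open>n\<close> is composite, \<open>n = p q k\<close> with primes \<open>p\<close> and \<open>q\<close>. If \<open>p \<noteq> q\<close>, the four divisors
  \<open>1, p, q, pq\<close> are all there are, and \<open>n\<close> is one of them. If \<open>p = q\<close> and \<open>k \<noteq> 1\<close>, the divisors are
  \<open>1, p, p\<^sup>2, n\<close>, and the complementary divisor \<open>n / p\<close> can only be \<open>p\<^sup>2\<close>.\<close>

lemma divisor_count_3_or_4:
  fixes n :: nat
  assumes "card {d. d dvd n} \<in> {3, 4}"
  shows "\<exists>p. Factorial_Ring.prime p \<and> (n = p ^ 2 \<or> n = p ^ 3 \<or>
    (\<exists>q. Factorial_Ring.prime q \<and> p \<noteq> q \<and> n = p * q))"
proof -
  let ?D = "{d. d dvd n}"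
  have fin: "finite ?D" using assms card.infinite by fastforce
  have n0: "n > 0" using assms by (cases "n = 0") auto
  have "n \<noteq> 1" using assms by auto
  then obtain p where p: "Factorial_Ring.prime p" "p dvd n" using prime_factor_nat by blast
  then obtain m where m: "n = p * m" by blast
  have p1: "p > 1" using p prime_gt_1_nat by blast
  have "m \<noteq> 1"
  proof
    assume "m = 1"
    then show False using assms divisor_count_prime_power[OF p(1), of 1] m by auto
  qed
  then obtain q where q: "Factorial_Ring.prime q" "q dvd m" using prime_factor_nat by blast
  then obtain k where k: "m = q * k" by blast
  have q1: "q > 1" using q prime_gt_1_nat by blast
  have k0: "k > 0" using n0 m k by auto
  \<comment> \<open>There are at most four divisors, so any four of them are all.\<close>
  have full: "?D = S" if "S \<subseteq> ?D" "card S = 4" for S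
    using that assms fin card_mono[OF fin that(1)] by (intro card_subset_eq[symmetric]) auto
  show ?thesis
  proof (cases "p = q")
    case False
    have "?D = {1, p, q, p * q}"
      using False p1 q1 m k by (intro full) auto
    moreover have "n \<in> ?D" by simp
    ultimately have "n \<in> {1, p, q, p * q}" by blast
    moreover have "p dvd n" "q dvd n" using m k by auto
    moreover have "\<not> p dvd q" "\<not> q dvd p" using False p q primes_dvd_imp_eq by blast+
    ultimately have "n = p * q" using p1 q1 by auto
    then show ?thesis using p q False by blast
  next
    case True
    have nk: "n = p ^ 2 * k" using m k True by (simp add: power2_eq_square)
    show ?thesis
    proof (cases "k = 1")
      case False
      have "p < p ^ 2" using p1 by (simp add: power2_eq_square)
      moreover have "p ^ 2 < n" using nk False k0 p1 by simp
      ultimately have "card {1, p, p ^ 2, n} = 4" using p1 by simp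
      then have "?D = {1, p, p ^ 2, n}" using nk by (intro full) auto
      moreover have "p * k \<in> ?D" using nk by (simp add: power2_eq_square)
      ultimately have "p * k \<in> {1, p, p ^ 2, n}" by blast
      then have "k = p" using p1 False k0 nk by (auto simp: power2_eq_square)
      then show ?thesis using p nk by (auto simp: power2_eq_square power3_eq_cube)
    qed (use p nk in auto)
  qed
qed

lemma divisor_count_eq_3_iff:
  fixes n :: nat
  shows "card {d. d dvd n} = 3 \<longleftrightarrow> (\<exists>p. Factorial_Ring.prime p \<and> n = p ^ 2)"
proof
  assume c: "card {d. d dvd n} = 3"
  then obtain p where "Factorial_Ring.prime p" "n = p ^ 2 \<or> n = p ^ 3 \<or>
    (\<exists>q. Factorial_Ring.prime q \<and> p \<noteq> q \<and> n = p * q)"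
    using divisor_count_3_or_4 by blast
  then show "\<exists>p. Factorial_Ring.prime p \<and> n = p ^ 2"
    using c divisor_count_prime_power[of p 3] divisor_count_prime_mult_prime[of p] by auto
qed (use divisor_count_prime_power[where k = 2] in auto)

lemma divisor_count_eq_4_iff:
  fixes n :: nat
  shows "card {d. d dvd n} = 4 \<longleftrightarrow> (\<exists>p. Factorial_Ring.prime p \<and> n = p ^ 3) \<or>
    (\<exists>p q. Factorial_Ring.prime p \<and> Factorial_Ring.prime q \<and> p \<noteq> q \<and> n = p * q)"
proof
  assume c: "card {d. d dvd n} = 4"
  then obtain p where p: "Factorial_Ring.prime p" "n = p ^ 2 \<or> n = p ^ 3 \<or>
    (\<exists>q. Factorial_Ring.prime q \<and> p \<noteq> q \<and> n = p * q)"
    using divisor_count_3_or_4 by blast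
  moreover have "n \<noteq> p ^ 2" using c divisor_count_prime_power[OF p(1), of 2] by auto
  ultimately show "(\<exists>p. Factorial_Ring.prime p \<and> n = p ^ 3) \<or>
    (\<exists>p q. Factorial_Ring.prime p \<and> Factorial_Ring.prime q \<and> p \<noteq> q \<and> n = p * q)"
    by blast
qed (use divisor_count_prime_power[where k = 3] divisor_count_prime_mult_prime in auto)

section \<open>The classification\<close>

theorem theorem1p1:
  fixes G :: "('a, 'b) monoid_scheme"
  assumes "group G" and "finite (carrier G)"
  shows "(isolated_subgroups G = subgroups G \<longleftrightarrow> CP1_group G) \<and>
    (int (card (isolated_subgroups G)) = int (card (subgroups G)) - 1 \<longleftrightarrow>
      (\<exists>p::nat. Factorial_Ring.prime p \<and> G \<cong> integer_mod_group (p ^ 2))) \<and>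
    (int (card (isolated_subgroups G)) = int (card (subgroups G)) - 2 \<longleftrightarrow>
      (\<exists>p::nat. Factorial_Ring.prime p \<and> G \<cong> integer_mod_group (p ^ 3)) \<or>
      (\<exists>p q::nat. Factorial_Ring.prime p \<and> Factorial_Ring.prime q \<and> p \<noteq> q \<and>
         G \<cong> integer_mod_group (p * q)))"
proof -
  interpret group G by fact
  note fin = \<open>finite (carrier G)\<close>
  have sub: "isolated_subgroups G \<subseteq> subgroups G"
    by (auto simp: isolated_subgroups_def isolated_def subgroups_def)
  have count: "int (card (isolated_subgroups G)) = int (card (subgroups G)) - int k
      \<longleftrightarrow> card (nonisolated_subgroups G) = k" for k
    using card_isolated_plus_nonisolated[OF fin] by linarith
  have "isolated_subgroups G = subgroups G \<longleftrightarrow> CP1_group G"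
    using nonisolated_empty_iff[OF fin] sub unfolding nonisolated_subgroups_def by blast
  moreover have "card (nonisolated_subgroups G) = 1 \<longleftrightarrow>
      (\<exists>p::nat. Factorial_Ring.prime p \<and> G \<cong> integer_mod_group (p ^ 2))"
  proof -
    have "G \<cong> integer_mod_group (p ^ 2) \<longleftrightarrow> cyclic_group G \<and> order G = p ^ 2"
      if "Factorial_Ring.prime p" for p :: nat
      using that by (intro iso_integer_mod_group_iff) (simp add: prime_gt_0_nat)
    then have "(\<exists>p::nat. Factorial_Ring.prime p \<and> G \<cong> integer_mod_group (p ^ 2)) \<longleftrightarrow>
        cyclic_group G \<and> (\<exists>p. Factorial_Ring.prime p \<and> order G = p ^ 2)"
      by blast
    moreover have "card (nonisolated_subgroups G) = 1 \<longleftrightarrow>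
        cyclic_group G \<and> card {d. d dvd order G} = 3"
      using card_nonisolated_eq_iff[OF fin, of 1] by (simp add: numeral_eq_Suc)
    ultimately show ?thesis
      using divisor_count_eq_3_iff[of "order G"] by blast
  qed
  moreover have "card (nonisolated_subgroups G) = 2 \<longleftrightarrow>
      (\<exists>p::nat. Factorial_Ring.prime p \<and> G \<cong> integer_mod_group (p ^ 3)) \<or>
      (\<exists>p q::nat. Factorial_Ring.prime p \<and> Factorial_Ring.prime q \<and> p \<noteq> q \<and>
         G \<cong> integer_mod_group (p * q))"
  proof -
    have "G \<cong> integer_mod_group (p ^ 3) \<longleftrightarrow> cyclic_group G \<and> order G = p ^ 3"
      if "Factorial_Ring.prime p" for p :: nat
      using that by (intro iso_integer_mod_group_iff) (simp add: prime_gt_0_nat)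
    moreover have "G \<cong> integer_mod_group (p * q) \<longleftrightarrow> cyclic_group G \<and> order G = p * q"
      if "Factorial_Ring.prime p" "Factorial_Ring.prime q" for p q :: nat
      using that by (intro iso_integer_mod_group_iff) (simp add: prime_gt_0_nat)
    ultimately have "(\<exists>p::nat. Factorial_Ring.prime p \<and> G \<cong> integer_mod_group (p ^ 3)) \<or>
        (\<exists>p q::nat. Factorial_Ring.prime p \<and> Factorial_Ring.prime q \<and> p \<noteq> q \<and>
           G \<cong> integer_mod_group (p * q)) \<longleftrightarrow>
        cyclic_group G \<and> ((\<exists>p. Factorial_Ring.prime p \<and> order G = p ^ 3) \<or>
        (\<exists>p q. Factorial_Ring.prime p \<and> Factorial_Ring.prime q \<and> p \<noteq> q \<and> order G = p * q))"
      by blast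
    moreover have "card (nonisolated_subgroups G) = 2 \<longleftrightarrow>
        cyclic_group G \<and> card {d. d dvd order G} = 4"
      using card_nonisolated_eq_iff[OF fin, of 2] by (simp add: numeral_eq_Suc)
    ultimately show ?thesis
      using divisor_count_eq_4_iff[of "order G"] by blast
  qed
  ultimately show ?thesis
    using count[of 1] count[of 2] by simp
qed

end
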